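(* Let $D\ge 1$, $\sigma_1,\dots,\sigma_D>0$, $\lambda>0$, and consider the stationary RHMC and HMC chains for the Gaussian target with potential $\Phi(q)=\sum_{i=1}^D\frac{q_i^2}{2\sigma_i^2}$ (complete momentum randomization). Then the single-step equilibrium mean-squared displacement $\mathrm{MSD}=\sum_{i=1}^D\mathbb{E}|q_i(t_1)-q_i(0)|^2$ is, for RHMC with mean duration $\lambda$, $$\mathrm{MSD}^{\mathrm{RHMC}}=\sum_{i=1}^D\frac{2\lambda^2\sigma_i^2}{\sigma_i^2+\lambda^2},$$ and, for HMC with constant duration $\lambda$, $$\mathrm{MSD}^{\mathrm{HMC}}=\sum_{i=1}^D2\Big(1-\cos\Big(\frac{\lambda}{\sigma_i}\Big)\Big)\sigma_i^2.$$
   Context: Chains: with $t_0=0$, $t_{n+1}=t_n+\delta t_n$, $$q_i(t_{n+1})=\cos\!\Big(\frac{\delta t_n}{\sigma_i}\Big)q_i(t_n)+\sigma_i\sin\!\Big(\frac{\delta t_n}{\sigma_i}\Big)\xi_{i,n},\qquad 1\le i\le D,\ n\ge 0,$$ where $\xi_{i,n}$ are i.i.d. $\mathcal N(0,1)$. For RHMC the $\delta t_n$ are i.i.d. exponential with mean $\lambda$ (the same $\delta t_n$ for all components), independent of the $\xi_{i,n}$; for HMC, $\delta t_n=\lambda$ is constant. The chain is started at stationarity: $q_i(0)\sim\mathcal N(0,\sigma_i^2)$, independent across $i$ and independent of all $\delta t_n,\xi_{i,n}$. *)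

theory Defs
  imports "HOL-Probability.Probability"
begin

definition gaussian_potential :: "nat \<Rightarrow> (nat \<Rightarrow> real) \<Rightarrow> (nat \<Rightarrow> real) \<Rightarrow> real" where
  "gaussian_potential D \<sigma> x = (\<Sum>i\<in>{1..D}. (x i)\<^sup>2 / (2 * (\<sigma> i)\<^sup>2))"

text \<open>Independent centred normal components of standard deviations \<open>\<sigma> i\<close> are the target
  whose joint density is proportional to the exponential of minus the potential.\<close>

lemma prod_normal_density_eq_exp_potential:
  assumes "\<forall>i\<in>{1..D}. 0 < \<sigma> i"
  shows "(\<Prod>i\<in>{1..D}. normal_density 0 (\<sigma> i) (x i)) =
    exp (- gaussian_potential D \<sigma> x) / (\<Prod>i\<in>{1..D}. sqrt (2 * pi * (\<sigma> i)\<^sup>2))"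
  by (simp add: gaussian_potential_def normal_density_def exp_sum prod_dividef
      flip: sum_negf)

text \<open>With \<open>p\<close> the momentum drawn at the start of a step, one step of the chain follows the
  Hamiltonian flow of kinetic plus potential energy: \<open>q' = p\<close> and \<open>p' = - q / \<sigma>\<^sup>2\<close>.\<close>

definition flow_position :: "real \<Rightarrow> real \<Rightarrow> real \<Rightarrow> real \<Rightarrow> real" where
  "flow_position s t q p = cos (t / s) * q + s * sin (t / s) * p"

lemma flow_position_0: "flow_position s 0 q p = q"
  by (simp add: flow_position_def)

lemma flow_position_hamilton:
  assumes "s > 0"
  shows "\<exists>P. P 0 = p \<and>
    (\<forall>t. ((\<lambda>t. flow_position s t q p) has_real_derivative P t) (at t) \<and>
         (P has_real_derivative - flow_position s t q p / s\<^sup>2) (at t))"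
proof (intro exI[of _ "\<lambda>t. - sin (t / s) * q / s + cos (t / s) * p"] conjI allI)
  show "- sin (0 / s) * q / s + cos (0 / s) * p = p"
    by simp
  fix t
  show "((\<lambda>t. flow_position s t q p) has_real_derivative
      - sin (t / s) * q / s + cos (t / s) * p) (at t)"
    unfolding flow_position_def using assms
    by (auto intro!: derivative_eq_intros)
  show "((\<lambda>t. - sin (t / s) * q / s + cos (t / s) * p) has_real_derivative
      - flow_position s t q p / s\<^sup>2) (at t)"
    unfolding flow_position_def using assms
    by (auto intro!: derivative_eq_intros simp: field_simps power2_eq_square)
qed

datatype source = Init nat | Duration nat | Momentum nat nat

fun source_var ::
  "(nat \<Rightarrow> 'a \<Rightarrow> real) \<Rightarrow> (nat \<Rightarrow> 'a \<Rightarrow> real) \<Rightarrow> (nat \<Rightarrow> nat \<Rightarrow> 'a \<Rightarrow> real) \<Rightarrow> source \<Rightarrow> 'a \<Rightarrow> real"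
where
  "source_var q0 \<delta>t \<xi> (Init i) = q0 i"
| "source_var q0 \<delta>t \<xi> (Duration n) = \<delta>t n"
| "source_var q0 \<delta>t \<xi> (Momentum i n) = \<xi> i n"

definition sources :: "nat \<Rightarrow> source set" where
  "sources D = Init ` {1..D} \<union> range Duration \<union> {Momentum i n | i n. i \<in> {1..D}}"

text \<open>\<open>q i n\<close> is the \<open>i\<close>-th component at the random time \<open>t\<^sub>n = \<delta>t 0 + \<dots> + \<delta>t (n - 1)\<close>.
  The duration \<open>\<delta>t n\<close> is shared by all components. Independence of the initial components,
  durations and momenta is stated jointly; constant durations satisfy it trivially.\<close>

locale stationary_gaussian_chain = prob_space M
  for M :: "'a measure" +
  fixes D :: nat
    and \<sigma> :: "nat \<Rightarrow> real"
    and \<delta>t :: "nat \<Rightarrow> 'a \<Rightarrow> real"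
    and \<xi> :: "nat \<Rightarrow> nat \<Rightarrow> 'a \<Rightarrow> real"
    and q :: "nat \<Rightarrow> nat \<Rightarrow> 'a \<Rightarrow> real"
  assumes step: "\<And>i n \<omega>. i \<in> {1..D} \<Longrightarrow> \<omega> \<in> space M \<Longrightarrow>
      q i (Suc n) \<omega> = flow_position (\<sigma> i) (\<delta>t n \<omega>) (q i n \<omega>) (\<xi> i n \<omega>)"
    and init_normal: "\<And>i. i \<in> {1..D} \<Longrightarrow> distributed M lborel (q i 0) (normal_density 0 (\<sigma> i))"
    and momentum_normal: "\<And>i n. i \<in> {1..D} \<Longrightarrow> distributed M lborel (\<xi> i n) std_normal_density"
    and indep: "indep_vars (\<lambda>_. borel) (source_var (\<lambda>i. q i 0) \<delta>t \<xi>) (sources D)"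

text \<open>The parameter of \<^const>\<open>exponential_density\<close> is the rate, so mean \<open>l\<close> is rate \<open>1 / l\<close>.\<close>

locale stationary_RHMC = stationary_gaussian_chain +
  fixes l :: real
  assumes duration_exponential: "\<And>n. distributed M lborel (\<delta>t n) (exponential_density (1 / l))"

locale stationary_HMC = stationary_gaussian_chain +
  fixes l :: real
  assumes duration_const: "\<And>n \<omega>. \<omega> \<in> space M \<Longrightarrow> \<delta>t n \<omega> = l"

definition MSD :: "'a measure \<Rightarrow> nat \<Rightarrow> (nat \<Rightarrow> nat \<Rightarrow> 'a \<Rightarrow> real) \<Rightarrow> real" where
  "MSD M D q = (\<Sum>i\<in>{1..D}. LINT \<omega>|M. \<bar>q i 1 \<omega> - q i 0 \<omega>\<bar>\<^sup>2)"

text \<open>The Bochner integral of a non-integrable function is 0, so finiteness of the expectations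
  is a separate property.\<close>

definition finite_MSD :: "'a measure \<Rightarrow> nat \<Rightarrow> (nat \<Rightarrow> nat \<Rightarrow> 'a \<Rightarrow> real) \<Rightarrow> bool" where
  "finite_MSD M D q \<longleftrightarrow> (\<forall>i\<in>{1..D}. integrable M (\<lambda>\<omega>. \<bar>q i 1 \<omega> - q i 0 \<omega>\<bar>\<^sup>2))"

end

theory Submission
  imports Defs
begin

text \<open>Write \<open>s\<close> for \<open>\<sigma> i\<close>, \<open>c\<close> for \<open>cos (\<delta>t 0 / s)\<close> and \<open>d\<close> for \<open>sin (\<delta>t 0 / s)\<close>. The displacement
  of component \<open>i\<close> in the first step is \<open>(c - 1) q + s d \<xi>\<close>, where \<open>q\<close> is the initial position,
  \<open>\<xi>\<close> the momentum, and the duration, \<open>q\<close> and \<open>\<xi>\<close> are independent. As \<open>q\<close> and \<open>\<xi>\<close> are centred,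
  the cross term of the square has mean zero; at equilibrium \<open>q\<close> and \<open>s \<xi>\<close> have the same variance
  \<open>s\<^sup>2\<close>, so the other two terms combine to \<open>s\<^sup>2 ((c - 1)\<^sup>2 + d\<^sup>2) = 2 s\<^sup>2 (1 - c)\<close> inside the expectation.
  Hence the mean squared displacement is \<open>2 s\<^sup>2 (1 - E c)\<close> for every law of the durations
  (lemma \<open>expectation_square_displacement\<close>), and the law enters only through \<open>E c\<close>.

  A constant duration \<open>l\<close> gives \<open>E c = cos (l / s)\<close>. An exponential duration of rate \<open>1 / l\<close> gives
  the real part of the characteristic function of the exponential law at \<open>1 / s\<close>
  (lemma \<open>expectation_cos_exponential\<close>), which is \<open>s\<^sup>2 / (s\<^sup>2 + l\<^sup>2)\<close>.\<close>

section \<open>The cosine transform of the exponential law\<close>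

lemma integrable_exponential_cos:
  fixes k a :: real
  assumes "k > 0"
  shows "integrable lborel (\<lambda>x. exponential_density k x * cos (a * x))"
proof (rule Bochner_Integration.integrable_bound)
  interpret E: prob_space "density lborel (exponential_density k)"
    using assms by (rule prob_space_exponential_density)
  have "integrable (density lborel (exponential_density k)) (\<lambda>_. 1 :: real)"
    by simp
  then show "integrable lborel (exponential_density k)"
    by (subst (asm) integrable_density) (use exponential_density_nonneg[OF assms] in auto)
  show "AE x in lborel. norm (exponential_density k x * cos (a * x)) \<le> norm (exponential_density k x)"
    by (auto simp: abs_mult intro!: AE_I2 mult_left_le)
qed simp

lemma integral_exponential_cos:
  fixes k a :: real
  assumes "k > 0"
  shows "(LINT x|lborel. exponential_density k x * cos (a * x)) = k\<^sup>2 / (k\<^sup>2 + a\<^sup>2)"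
proof -
  define f where "f x = k * exp (- k * x) * cos (a * x)" for x
  \<comment> \<open>Real part of the antiderivative of \<open>k exp ((\<i> a - k) x)\<close>.\<close>
  define F where "F x = k * exp (- k * x) * (a * sin (a * x) - k * cos (a * x)) / (k\<^sup>2 + a\<^sup>2)" for x
  have pos: "k\<^sup>2 + a\<^sup>2 > 0"
    using assms by (simp add: add_pos_nonneg)
  have deriv: "(F has_real_derivative f x) (at x)" for x
  proof -
    have "((\<lambda>x. k * exp (- k * x) * (a * sin (a * x) - k * cos (a * x)))
        has_real_derivative f x * (k\<^sup>2 + a\<^sup>2)) (at x)"
      unfolding f_def
      by (auto intro!: derivative_eq_intros simp: algebra_simps power2_eq_square)
    from DERIV_cdivide[OF this, of "k\<^sup>2 + a\<^sup>2"] show ?thesis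
      using assms by (simp add: F_def[abs_def])
  qed
  have restrict: "indicator {0<..} x *\<^sub>R f x = exponential_density k x * cos (a * x)"
    if "x \<noteq> 0" for x
    using that by (auto simp: f_def exponential_density_def indicator_def mult.commute)
  have ae: "AE x in lborel. indicator {0<..} x *\<^sub>R f x = exponential_density k x * cos (a * x)"
    using AE_lborel_singleton[of 0] by eventually_elim (rule restrict)
  have meas: "f \<in> borel_measurable lborel"
    unfolding f_def by measurable
  have "(LINT x|lborel. exponential_density k x * cos (a * x)) =
      (LINT x|lborel. indicator {0<..} x *\<^sub>R f x)"
    using ae meas by (intro integral_cong_AE) (auto elim: eventually_mono)
  also have "\<dots> = (LBINT x=ereal 0..\<infinity>. f x)"
    by (simp add: interval_lebesgue_integral_0_infty set_lebesgue_integral_def zero_ereal_def[symmetric])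
  also have "\<dots> = 0 - F 0"
  proof (rule interval_integral_FTC_integrable)
    show "(F has_vector_derivative f x) (at x)" for x
      using deriv by (simp add: has_real_derivative_iff_has_vector_derivative)
    show "isCont f x" for x
      unfolding f_def by (intro continuous_intros)
    have "integrable lborel (\<lambda>x. indicator {0<..} x *\<^sub>R f x)"
      using integrable_exponential_cos[OF assms, of a] ae meas
      by (subst integrable_cong_AE) auto
    then show "set_integrable lborel (einterval (ereal 0) \<infinity>) f"
      by (simp add: set_integrable_def)
    have "(F \<longlongrightarrow> F 0) (at_right 0)"
      using DERIV_isCont[OF deriv[of 0]] by (simp add: isCont_def filterlim_at_split)
    then show "((F \<circ> real_of_ereal) \<longlongrightarrow> F 0) (at_right (ereal 0))"
      by (simp add: ereal_tendsto_simps)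
    have "(F \<longlongrightarrow> 0) at_top"
    proof (rule Lim_null_comparison)
      show "\<forall>\<^sub>F x in at_top. norm (F x) \<le> k * exp (- k * x) * ((\<bar>a\<bar> + k) / (k\<^sup>2 + a\<^sup>2))"
      proof (intro always_eventually allI)
        fix x
        have "\<bar>a * sin (a * x) - k * cos (a * x)\<bar> \<le> \<bar>a * sin (a * x)\<bar> + \<bar>k * cos (a * x)\<bar>"
          by (rule abs_triangle_ineq4)
        also have "\<dots> \<le> \<bar>a\<bar> + k"
          using assms by (intro add_mono) (auto simp: abs_mult intro!: mult_left_le)
        finally show "norm (F x) \<le> k * exp (- k * x) * ((\<bar>a\<bar> + k) / (k\<^sup>2 + a\<^sup>2))"
          using assms pos by (auto simp: F_def abs_mult intro!: divide_right_mono mult_left_mono)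
      qed
      have "((\<lambda>x. exp (- k * x)) \<longlongrightarrow> 0) at_top"
        using assms
        by (intro filterlim_compose[OF exp_at_bot] filterlim_tendsto_neg_mult_at_bot[OF tendsto_const])
          (auto simp: filterlim_ident)
      from tendsto_mult[OF tendsto_mult[OF tendsto_const this, of k]
          tendsto_const[of "(\<bar>a\<bar> + k) / (k\<^sup>2 + a\<^sup>2)"]]
      show "((\<lambda>x. k * exp (- k * x) * ((\<bar>a\<bar> + k) / (k\<^sup>2 + a\<^sup>2))) \<longlongrightarrow> 0) at_top"
        by simp
    qed
    then show "((F \<circ> real_of_ereal) \<longlongrightarrow> 0) (at_left \<infinity>)"
      by (simp add: ereal_tendsto_simps)
  qed simp
  finally show ?thesis
    by (simp add: F_def power2_eq_square)
qed

lemma (in prob_space) expectation_cos_exponential: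
  assumes "k > 0" and "distributed M lborel X (exponential_density k)"
  shows "expectation (\<lambda>\<omega>. cos (a * X \<omega>)) = k\<^sup>2 / (k\<^sup>2 + a\<^sup>2)"
  using distributed_integral[OF assms(2), of "\<lambda>x. cos (a * x)"]
    exponential_density_nonneg[OF assms(1)] integral_exponential_cos[OF assms(1)]
  by simp

section \<open>Normal moments\<close>

lemma (in prob_space) normal_centred_moments:
  assumes s: "s > 0" and D: "distributed M lborel X (normal_density 0 s)"
  shows "expectation X = 0"
    and "expectation (\<lambda>\<omega>. (X \<omega>)\<^sup>2) = s\<^sup>2"
    and "integrable M X"
    and "integrable M (\<lambda>\<omega>. (X \<omega>)\<^sup>2)"
proof -
  show mean: "expectation X = 0"
    using normal_distributed_expectation[OF s D] .
  show "expectation (\<lambda>\<omega>. (X \<omega>)\<^sup>2) = s\<^sup>2"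
    using normal_distributed_variance[OF s D] mean by simp
  show "integrable M X"
    using distributed_integrable[OF D, of "\<lambda>x. x"] integrable_normal_moment[OF s, of 0 1] by simp
  show "integrable M (\<lambda>\<omega>. (X \<omega>)\<^sup>2)"
    using distributed_integrable[OF D, of "\<lambda>x. x\<^sup>2"] integrable_normal_moment[OF s, of 0 2] by simp
qed

section \<open>One step of the chain\<close>

context stationary_gaussian_chain
begin

lemma random_variable_source:
  assumes "i \<in> {1..D}"
  shows "random_variable borel (\<delta>t n)" "random_variable borel (q i 0)" "random_variable borel (\<xi> i n)"
proof -
  have *: "random_variable borel (source_var (\<lambda>i. q i 0) \<delta>t \<xi> x)" if "x \<in> sources D" for x
    using indep that by (simp add: indep_vars_def)
  show "random_variable borel (\<delta>t n)" "random_variable borel (q i 0)" "random_variable borel (\<xi> i n)"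
    using *[of "Duration n"] *[of "Init i"] *[of "Momentum i n"] assms
    by (auto simp: sources_def)
qed

text \<open>Every term of the squared displacement of one component is a product of functions of these
  three independent sources.\<close>

lemma expectation_source_product:
  fixes f g h :: "real \<Rightarrow> real"
  assumes i: "i \<in> {1..D}"
    and [measurable]: "f \<in> borel_measurable borel" "g \<in> borel_measurable borel" "h \<in> borel_measurable borel"
    and int: "integrable M (\<lambda>\<omega>. f (\<delta>t n \<omega>))" "integrable M (\<lambda>\<omega>. g (q i 0 \<omega>))"
      "integrable M (\<lambda>\<omega>. h (\<xi> i n \<omega>))"
  shows "integrable M (\<lambda>\<omega>. f (\<delta>t n \<omega>) * (g (q i 0 \<omega>) * h (\<xi> i n \<omega>)))" (is ?int)
    and "expectation (\<lambda>\<omega>. f (\<delta>t n \<omega>) * (g (q i 0 \<omega>) * h (\<xi> i n \<omega>))) =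
      expectation (\<lambda>\<omega>. f (\<delta>t n \<omega>)) *
        (expectation (\<lambda>\<omega>. g (q i 0 \<omega>)) * expectation (\<lambda>\<omega>. h (\<xi> i n \<omega>)))" (is ?exp)
proof -
  define I where "I = {Duration n, Init i, Momentum i n}"
  define \<phi> where "\<phi> x = (case x of Duration _ \<Rightarrow> f | Init _ \<Rightarrow> g | Momentum _ _ \<Rightarrow> h)" for x
  define Y where "Y x \<omega> = \<phi> x (source_var (\<lambda>i. q i 0) \<delta>t \<xi> x \<omega>)" for x \<omega>
  have sub: "I \<subseteq> sources D"
    using i by (auto simp: I_def sources_def)
  have "indep_vars (\<lambda>_. borel) Y I"
    unfolding Y_def
    by (rule indep_vars_compose2[OF indep_vars_subset[OF indep sub]])
      (auto simp: \<phi>_def split: source.split)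
  moreover have "integrable M (Y x)" if "x \<in> I" for x
    using that int by (auto simp: I_def Y_def[abs_def] \<phi>_def)
  moreover have "finite I"
    by (simp add: I_def)
  ultimately have "integrable M (\<lambda>\<omega>. \<Prod>x\<in>I. Y x \<omega>)"
    and "expectation (\<lambda>\<omega>. \<Prod>x\<in>I. Y x \<omega>) = (\<Prod>x\<in>I. expectation (Y x))"
    by (blast intro: indep_vars_integrable indep_vars_lebesgue_integral)+
  then show ?int ?exp
    by (simp_all add: I_def Y_def[abs_def] \<phi>_def)
qed

text \<open>The duration enters only through bounded functions, so integrability comes from the normal
  second moments alone. Stationarity is what gives both squares the same factor \<open>(\<sigma> i)\<^sup>2\<close>.\<close>

lemma expectation_square_displacement:
  assumes i: "i \<in> {1..D}" and s: "\<sigma> i > 0"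
  shows "integrable M (\<lambda>\<omega>. \<bar>q i 1 \<omega> - q i 0 \<omega>\<bar>\<^sup>2)" (is ?int)
    and "expectation (\<lambda>\<omega>. \<bar>q i 1 \<omega> - q i 0 \<omega>\<bar>\<^sup>2) =
      2 * (1 - expectation (\<lambda>\<omega>. cos (\<delta>t 0 \<omega> / \<sigma> i))) * (\<sigma> i)\<^sup>2" (is ?exp)
proof -
  note [measurable] = random_variable_source[OF i]
  define c where "c t = cos (t / \<sigma> i)" for t
  define d where "d t = sin (t / \<sigma> i)" for t
  have [measurable]: "c \<in> borel_measurable borel" "d \<in> borel_measurable borel"
    unfolding c_def d_def by measurable
  have c: "\<bar>c t\<bar> \<le> 1" and d: "\<bar>d t\<bar> \<le> 1" and cd: "(d t)\<^sup>2 = 1 - (c t)\<^sup>2" for t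
    by (simp_all add: c_def d_def sin_squared_eq)
  have int_c: "integrable M (\<lambda>\<omega>. c (\<delta>t 0 \<omega>))"
    by (rule integrable_const_bound[of _ 1]) (use c in auto)
  have int_c2: "integrable M (\<lambda>\<omega>. (c (\<delta>t 0 \<omega>))\<^sup>2)"
    by (rule integrable_const_bound[of _ 1]) (use c in \<open>auto simp: abs_square_le_1\<close>)
  have int_cd: "integrable M (\<lambda>\<omega>. (c (\<delta>t 0 \<omega>) - 1) * d (\<delta>t 0 \<omega>))"
  proof (rule integrable_const_bound[of _ "2 * 1"])
    have "\<bar>c t - 1\<bar> * \<bar>d t\<bar> \<le> 2 * 1" for t
      using c[of t] d[of t] by (intro mult_mono) auto
    then show "AE \<omega> in M. norm ((c (\<delta>t 0 \<omega>) - 1) * d (\<delta>t 0 \<omega>)) \<le> 2 * 1"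
      by (simp add: abs_mult)
  qed simp
  have int_A: "integrable M (\<lambda>\<omega>. (c (\<delta>t 0 \<omega>) - 1)\<^sup>2)"
    using int_c int_c2 by (simp add: power2_diff)
  have int_C: "integrable M (\<lambda>\<omega>. (d (\<delta>t 0 \<omega>))\<^sup>2)"
    using int_c2 by (simp add: cd)
  have E_A: "expectation (\<lambda>\<omega>. (c (\<delta>t 0 \<omega>) - 1)\<^sup>2) =
      expectation (\<lambda>\<omega>. (c (\<delta>t 0 \<omega>))\<^sup>2) + 1 - 2 * expectation (\<lambda>\<omega>. c (\<delta>t 0 \<omega>))"
    using int_c int_c2 by (simp add: power2_diff prob_space)
  have E_C: "expectation (\<lambda>\<omega>. (d (\<delta>t 0 \<omega>))\<^sup>2) = 1 - expectation (\<lambda>\<omega>. (c (\<delta>t 0 \<omega>))\<^sup>2)"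
    using int_c2 by (simp add: cd prob_space)
  note Q = normal_centred_moments[OF s init_normal[OF i]]
  note X = normal_centred_moments[OF zero_less_one momentum_normal[OF i, of 0]]
  \<comment> \<open>The squared displacement is \<open>A + 2 (\<sigma> i) B + (\<sigma> i)\<^sup>2 C\<close>. The factors 1 put each term into the form
    of a product over the three independent sources.\<close>
  define A where "A \<omega> = (c (\<delta>t 0 \<omega>) - 1)\<^sup>2 * ((q i 0 \<omega>)\<^sup>2 * 1)" for \<omega>
  define B where "B \<omega> = (c (\<delta>t 0 \<omega>) - 1) * d (\<delta>t 0 \<omega>) * (q i 0 \<omega> * \<xi> i 0 \<omega>)" for \<omega>
  define C where "C \<omega> = (d (\<delta>t 0 \<omega>))\<^sup>2 * (1 * (\<xi> i 0 \<omega>)\<^sup>2)" for \<omega>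
  note sources_A = expectation_source_product[OF i, of "\<lambda>t. (c t - 1)\<^sup>2" "\<lambda>x. x\<^sup>2" "\<lambda>_. 1" 0,
      OF _ _ _ int_A Q(4) integrable_const]
  note sources_B = expectation_source_product[OF i, of "\<lambda>t. (c t - 1) * d t" "\<lambda>x. x" "\<lambda>x. x" 0,
      OF _ _ _ int_cd Q(3) X(3)]
  note sources_C = expectation_source_product[OF i, of "\<lambda>t. (d t)\<^sup>2" "\<lambda>_. 1" "\<lambda>x. x\<^sup>2" 0,
      OF _ _ _ int_C integrable_const X(4)]
  have A: "integrable M A" "expectation A = expectation (\<lambda>\<omega>. (c (\<delta>t 0 \<omega>) - 1)\<^sup>2) * (\<sigma> i)\<^sup>2"
    unfolding A_def
    subgoal by (rule sources_A(1)) measurable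
    subgoal by (subst sources_A(2)) (simp_all only: Q(2), simp_all add: prob_space)
    done
  have B: "integrable M B" "expectation B = 0"
    unfolding B_def
    subgoal by (rule sources_B(1)) measurable
    subgoal by (subst sources_B(2)) (simp_all only: Q(1), simp_all)
    done
  have C: "integrable M C" "expectation C = expectation (\<lambda>\<omega>. (d (\<delta>t 0 \<omega>))\<^sup>2)"
    unfolding C_def
    subgoal by (rule sources_C(1)) measurable
    subgoal by (subst sources_C(2)) (simp_all only: X(2), simp_all add: prob_space)
    done
  have eq: "\<bar>q i 1 \<omega> - q i 0 \<omega>\<bar>\<^sup>2 = A \<omega> + 2 * \<sigma> i * B \<omega> + (\<sigma> i)\<^sup>2 * C \<omega>"
    if "\<omega> \<in> space M" for \<omega>
    using step[OF i that, of 0]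
    by (simp add: flow_position_def A_def B_def C_def c_def d_def power2_eq_square algebra_simps)
  have int: "integrable M (\<lambda>\<omega>. A \<omega> + 2 * \<sigma> i * B \<omega> + (\<sigma> i)\<^sup>2 * C \<omega>)"
    using A B C by simp
  then show ?int
    by (subst Bochner_Integration.integrable_cong[OF refl eq]) auto
  have "expectation (\<lambda>\<omega>. \<bar>q i 1 \<omega> - q i 0 \<omega>\<bar>\<^sup>2) =
      expectation (\<lambda>\<omega>. A \<omega> + 2 * \<sigma> i * B \<omega> + (\<sigma> i)\<^sup>2 * C \<omega>)"
    by (rule Bochner_Integration.integral_cong[OF refl eq])
  also have "\<dots> = (expectation (\<lambda>\<omega>. (c (\<delta>t 0 \<omega>) - 1)\<^sup>2) + expectation (\<lambda>\<omega>. (d (\<delta>t 0 \<omega>))\<^sup>2)) * (\<sigma> i)\<^sup>2"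
    using A B C by (simp add: algebra_simps)
  also have "\<dots> = 2 * (1 - expectation (\<lambda>\<omega>. c (\<delta>t 0 \<omega>))) * (\<sigma> i)\<^sup>2"
    by (simp add: E_A E_C algebra_simps)
  finally show ?exp
    by (simp add: c_def)
qed

lemma MSD_eq_expectation_cos:
  assumes "\<forall>i\<in>{1..D}. \<sigma> i > 0"
  shows "finite_MSD M D q"
    and "MSD M D q =
      (\<Sum>i\<in>{1..D}. 2 * (1 - expectation (\<lambda>\<omega>. cos (\<delta>t 0 \<omega> / \<sigma> i))) * (\<sigma> i)\<^sup>2)"
  using assms expectation_square_displacement by (auto simp: finite_MSD_def MSD_def intro!: sum.cong)

end

lemma (in stationary_RHMC) MSD_RHMC:
  assumes \<sigma>: "\<forall>i\<in>{1..D}. \<sigma> i > 0" and l: "l > 0"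
  shows "MSD M D q = (\<Sum>i\<in>{1..D}. 2 * l\<^sup>2 * (\<sigma> i)\<^sup>2 / ((\<sigma> i)\<^sup>2 + l\<^sup>2))"
  unfolding MSD_eq_expectation_cos(2)[OF \<sigma>]
proof (rule sum.cong[OF refl])
  fix i assume "i \<in> {1..D}"
  with \<sigma> have s: "\<sigma> i > 0"
    by blast
  have "expectation (\<lambda>\<omega>. cos (\<delta>t 0 \<omega> / \<sigma> i)) = (1 / l)\<^sup>2 / ((1 / l)\<^sup>2 + (1 / \<sigma> i)\<^sup>2)"
    using expectation_cos_exponential[OF _ duration_exponential, of "1 / \<sigma> i" 0] l by simp
  also have "1 - \<dots> = l\<^sup>2 / ((\<sigma> i)\<^sup>2 + l\<^sup>2)"
  proof -
    have "(\<sigma> i)\<^sup>2 + l\<^sup>2 > 0"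
      using l by (simp add: add_nonneg_pos)
    moreover have "(1 / l)\<^sup>2 / ((1 / l)\<^sup>2 + (1 / \<sigma> i)\<^sup>2) = (\<sigma> i)\<^sup>2 / ((\<sigma> i)\<^sup>2 + l\<^sup>2)"
      using s l by (simp add: field_simps add_pos_pos)
    ultimately show ?thesis
      by (simp only: diff_divide_eq_iff) simp
  qed
  finally show "2 * (1 - expectation (\<lambda>\<omega>. cos (\<delta>t 0 \<omega> / \<sigma> i))) * (\<sigma> i)\<^sup>2 =
      2 * l\<^sup>2 * (\<sigma> i)\<^sup>2 / ((\<sigma> i)\<^sup>2 + l\<^sup>2)"
    by simp
qed

lemma (in stationary_HMC) MSD_HMC:
  assumes "\<forall>i\<in>{1..D}. \<sigma> i > 0"
  shows "MSD M D q = (\<Sum>i\<in>{1..D}. 2 * (1 - cos (l / \<sigma> i)) * (\<sigma> i)\<^sup>2)"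
proof -
  have "expectation (\<lambda>\<omega>. cos (\<delta>t 0 \<omega> / \<sigma> i)) = expectation (\<lambda>_. cos (l / \<sigma> i))" for i
    by (rule Bochner_Integration.integral_cong) (simp_all add: duration_const)
  then show ?thesis
    by (simp add: MSD_eq_expectation_cos(2)[OF assms] prob_space)
qed

theorem mainTheorem10:
  fixes D :: nat and \<sigma> :: "nat \<Rightarrow> real" and l :: real
    and M :: "'a measure" and \<delta>t :: "nat \<Rightarrow> 'a \<Rightarrow> real" and \<xi> q :: "nat \<Rightarrow> nat \<Rightarrow> 'a \<Rightarrow> real"
    and M' :: "'b measure" and \<delta>t' :: "nat \<Rightarrow> 'b \<Rightarrow> real" and \<xi>' q' :: "nat \<Rightarrow> nat \<Rightarrow> 'b \<Rightarrow> real"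
  assumes "D \<ge> 1" and "\<forall>i\<in>{1..D}. \<sigma> i > 0" and "l > 0"
  shows "(stationary_RHMC M D \<sigma> \<delta>t \<xi> q l \<longrightarrow>
            finite_MSD M D q \<and>
            MSD M D q = (\<Sum>i\<in>{1..D}. 2 * l\<^sup>2 * (\<sigma> i)\<^sup>2 / ((\<sigma> i)\<^sup>2 + l\<^sup>2)))
       \<and> (stationary_HMC M' D \<sigma> \<delta>t' \<xi>' q' l \<longrightarrow>
            finite_MSD M' D q' \<and>
            MSD M' D q' = (\<Sum>i\<in>{1..D}. 2 * (1 - cos (l / \<sigma> i)) * (\<sigma> i)\<^sup>2))"
proof (intro conjI[of "_ \<longrightarrow> _"] impI conjI[of "finite_MSD _ _ _"])
  assume "stationary_RHMC M D \<sigma> \<delta>t \<xi> q l"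
  then interpret stationary_RHMC M D \<sigma> \<delta>t \<xi> q l .
  show "finite_MSD M D q"
    using assms(2) by (rule MSD_eq_expectation_cos)
  show "MSD M D q = (\<Sum>i\<in>{1..D}. 2 * l\<^sup>2 * (\<sigma> i)\<^sup>2 / ((\<sigma> i)\<^sup>2 + l\<^sup>2))"
    using assms(2,3) by (rule MSD_RHMC)
next
  assume "stationary_HMC M' D \<sigma> \<delta>t' \<xi>' q' l"
  then interpret stationary_HMC M' D \<sigma> \<delta>t' \<xi>' q' l .
  show "finite_MSD M' D q'"
    using assms(2) by (rule MSD_eq_expectation_cos)
  show "MSD M' D q' = (\<Sum>i\<in>{1..D}. 2 * (1 - cos (l / \<sigma> i)) * (\<sigma> i)\<^sup>2)"
    using assms(2) by (rule MSD_HMC)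
qed

end
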